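(* Let $\mathcal L(\Omega,\lambda)=J(\Omega)-\lambda C(\Omega)$ for $\Omega\in\mathcal D_{ad}$, $\lambda\in\mathbb R$. Let $(\Omega^*,\lambda^* )\in\mathcal D_{ad}\times\mathbb R$ be a saddle point of $\mathcal L$, i.e. $$\mathcal L(\Omega^*,\lambda)\le\mathcal L(\Omega^*,\lambda^* )\le\mathcal L(\Omega,\lambda^* )\qquad\text{for all }\Omega\in\mathcal D_{ad},\ \lambda\in\mathbb R.$$ If $J$ and $C$ admit a directional derivative at $\Omega^*$ in the direction $U\in\mathcal U(\overline{\Omega^*},\mathbb R^3)$, then $$DJ(\Omega^* ).U=\lambda^*\,DC(\Omega^* ).U .$$
   Context: Physical setting. $\Omega_e\subset\mathbb R^3$ is a fixed bounded domain. The solid region $\Omega_S$ is the fixed part of $\Omega_e$ lying below the plane $\{z=0\}$. The liquid drop $\Omega_L\subset\Omega_e$ sits on this plane (in $z>0$), and the gas region $\Omega_G$ is the rest of $\Omega_e$ above the plane. $\Gamma_{LS}$ (contained in $\{z=0\}$), $\Gamma_{LG}$, $\Gamma_{GS}$ are the liquid-solid, liquid-gas and gas-solid interfaces. $\Gamma_e$ denotes the external boundary of $\Omega_e$; it consists of $\Gamma_0$ (the part of the boundary of $\Omega_S$ carrying the counter-electrode), $\Gamma_{eG}$ (gas side) and $\Gamma_{eS}$ (solid side). Put $\Omega=\Omega_e\setminus\overline{\Omega_L}$; giving $\Omega$ is equivalent to giving $\Omega_L$. Domains are open with Lipschitz boundary. $\varepsilon$ is the function on $\Omega$ equal to a constant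 $\varepsilon_G>0$ on $\Omega_G$ and a constant $\varepsilon_S>0$ on $\Omega_S$. Potential. For a constant $\phi_0\ge 0$, $\phi^\Omega$ is the unique element of $H(\Omega)=\{\psi\in H^1(\Omega):\psi=0\text{ on }\Gamma_0,\ \psi=\phi_0\text{ on }\Gamma_{LS}\cup\Gamma_{LG}\}$ such that $\int_\Omega\varepsilon\langle\nabla\phi^\Omega,\nabla\psi\rangle\,d\Omega=0$ for all $\psi\in H_0(\Omega)=\{\psi\in H^1(\Omega):\psi=0\text{ on }\Gamma_0\cup\Gamma_{LS}\cup\Gamma_{LG}\}$. Energy and constraint. With surface tensions $\sigma_{LG}>0,\sigma_{LS},\sigma_{GS}$, density $\rho$ and gravity $g$, set $\alpha=\rho g/\sigma_{LG}$, $\mu=(\sigma_{LS}-\sigma_{GS})/\sigma_{LG}$, $\delta=1/\sigma_{LG}$, and $$J(\Omega)=-\alpha\int_\Omega z\,d\Omega+\mu\int_{\Gamma_{LS}}d\sigma+\int_{\Gamma_{LG}}d\sigma-\frac{\delta}{2}\int_\Omega\varepsilon|\nabla\phi^\Omega|^2\,d\Omega .$$ For a prescribed volume $V$, $C(\Omega)=\mathrm{Vol}(\Omega_e\setminus\overline\Omega)-V$. Admissible domains. $\mathcal C^1(\overline\Omega,\mathbb R^3)$ is the set of restrictions to $\overline\Omega$ of maps in $\mathcal C^1(\mathbb R^3,\mathbb R^3)$, with norm $\|U\|_\infty=\sup_{\overline\Omega}|U|+\sup_{\overline\Omega}|DU|$. Set $\mathcal U(\overline\Omega,\mathbb R^3)=\{U\in\mathcal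 C^1(\overline\Omega,\mathbb R^3):\|U\|_\infty<1,\ U_z|_{\Omega_S}\equiv 0,\ U|_{\Gamma_e}\equiv 0\}$ and $\Omega+U=(Id+U)(\Omega)$. A fixed reference domain $\Omega^0=\Omega_e\setminus\overline{\Omega_L^0}$, open with Lipschitz boundary, is given, where $\Omega_L^0\subset\Omega_e\cap\{z>0\}$ is a fixed reference liquid drop sitting on the plane $\{z=0\}$, and $\mathcal D_{ad}=\{\Omega^0+U:U\in\mathcal U(\overline{\Omega^0},\mathbb R^3)\}$. The solid region of $(Id+U)(\Omega)$ is still $\Omega_S$, and its gas region and interfaces are the images under $Id+U$ of those of $\Omega$. Directional derivative. A real-valued function $K$ on $\mathcal D_{ad}$ has a directional derivative at $\Omega\in\mathcal D_{ad}$ in the direction $U\in\mathcal U(\overline\Omega,\mathbb R^3)$ if the function $K^*:V\mapsto K((Id+V)(\Omega))$ has a directional derivative at $0$ in the direction $U$ in the usual sense, i.e. if $\lim_{t\to0}\frac{K^*(tU)-K^*(0)}{t}$ exists; this limit is denoted $DK(\Omega).U$. *)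

theory Defs
  imports "HOL-Analysis.Analysis"
begin

type_synonym R3 = "real^3"

section \<open>Two-dimensional Hausdorff measure\<close>

definition hausdorff2_pre :: "real \<Rightarrow> R3 set \<Rightarrow> ennreal" where
  "hausdorff2_pre d A =
     (INF C \<in> {C :: nat \<Rightarrow> R3 set. A \<subseteq> (\<Union>i. C i) \<and> (\<forall>i. bounded (C i) \<and> diameter (C i) \<le> d)}.
        \<Sum>i. ennreal (pi / 4 * (diameter (C i))\<^sup>2))"

definition hausdorff2 :: "R3 set \<Rightarrow> ennreal" where
  "hausdorff2 A = (SUP d \<in> {0<..}. hausdorff2_pre d A)"

text \<open>A metric outer measure, hence countably additive on the Borel sets; the factor \<open>pi / 4\<close> makes it
  agree with surface area.\<close>

definition surface_measure :: "R3 measure" where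
  "surface_measure = measure_of UNIV (sets borel) hausdorff2"

section \<open>Sobolev space and traces\<close>

definition grad :: "(R3 \<Rightarrow> real) \<Rightarrow> R3 \<Rightarrow> R3" where
  "grad f x = (\<chi> i. frechet_derivative f (at x) (axis i 1))"

primrec Ck :: "nat \<Rightarrow> (R3 \<Rightarrow> real) \<Rightarrow> bool" where
  "Ck 0 f \<longleftrightarrow> continuous_on UNIV f"
| "Ck (Suc k) f \<longleftrightarrow> f differentiable_on UNIV \<and> (\<forall>i. Ck k (\<lambda>x. grad f x $ i))"

definition test_function :: "R3 set \<Rightarrow> (R3 \<Rightarrow> real) \<Rightarrow> bool" where
  "test_function S \<eta> \<longleftrightarrow>
     (\<forall>k. Ck k \<eta>) \<and> compact (closure {x. \<eta> x \<noteq> 0}) \<and> closure {x. \<eta> x \<noteq> 0} \<subseteq> S"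

definition square_integrable :: "'a measure \<Rightarrow> ('a \<Rightarrow> 'b::euclidean_space) \<Rightarrow> bool" where
  "square_integrable M f \<longleftrightarrow> f \<in> borel_measurable M \<and> integrable M (\<lambda>x. (norm (f x))\<^sup>2)"

definition weak_gradient :: "R3 set \<Rightarrow> (R3 \<Rightarrow> real) \<Rightarrow> (R3 \<Rightarrow> R3) \<Rightarrow> bool" where
  "weak_gradient S u G \<longleftrightarrow> square_integrable (lebesgue_on S) G \<and>
     (\<forall>\<eta>. test_function S \<eta> \<longrightarrow>
        (LINT x|lebesgue_on S. u x *\<^sub>R grad \<eta> x) = - (LINT x|lebesgue_on S. \<eta> x *\<^sub>R G x))"

definition H1 :: "R3 set \<Rightarrow> (R3 \<Rightarrow> real) set" where
  "H1 S = {u. square_integrable (lebesgue_on S) u \<and> (\<exists>G. weak_gradient S u G)}"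

text \<open>The weak gradient is unique only up to null sets; any representative will do.\<close>

definition wgrad :: "R3 set \<Rightarrow> (R3 \<Rightarrow> real) \<Rightarrow> R3 \<Rightarrow> R3" where
  "wgrad S u = (SOME G. weak_gradient S u G)"

text \<open>The trace is the continuous extension, from \<open>H1 S\<close> to square-integrable functions on the
  boundary, of the restriction operator on functions that are continuously differentiable up to
  the boundary.\<close>

definition has_trace :: "R3 set \<Rightarrow> (R3 \<Rightarrow> real) \<Rightarrow> (R3 \<Rightarrow> real) \<Rightarrow> bool" where
  "has_trace S u T \<longleftrightarrow>
     square_integrable (restrict_space surface_measure (frontier S)) T \<and>
     (\<exists>v :: nat \<Rightarrow> R3 \<Rightarrow> real.
        (\<forall>n. Ck 1 (v n)) \<and>
        (\<lambda>n. \<integral>\<^sup>+x. ennreal ((v n x - u x)\<^sup>2) \<partial>lebesgue_on S) \<longlonglongrightarrow> 0 \<and>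
        (\<lambda>n. \<integral>\<^sup>+x. ennreal ((norm (grad (v n) x - wgrad S u x))\<^sup>2) \<partial>lebesgue_on S) \<longlonglongrightarrow> 0 \<and>
        (\<lambda>n. \<integral>\<^sup>+x. ennreal ((v n x - T x)\<^sup>2)
               \<partial>restrict_space surface_measure (frontier S)) \<longlonglongrightarrow> 0)"

definition trace_eq :: "R3 set \<Rightarrow> (R3 \<Rightarrow> real) \<Rightarrow> R3 set \<Rightarrow> real \<Rightarrow> bool" where
  "trace_eq S u \<Gamma> c \<longleftrightarrow>
     (\<exists>T. has_trace S u T \<and> (AE x in surface_measure. x \<in> \<Gamma> \<longrightarrow> T x = c))"

section \<open>The electrowetting configuration\<close>

text \<open>Near every boundary point the set is, for some unit vector \<open>e\<close>, the part strictly above the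
  graph of a Lipschitz function on the plane orthogonal to \<open>e\<close>.\<close>

definition lipschitz_boundary :: "R3 set \<Rightarrow> bool" where
  "lipschitz_boundary S \<longleftrightarrow>
     (\<forall>p \<in> frontier S. \<exists>e r L \<gamma>. norm e = 1 \<and> r > 0 \<and>
        L-lipschitz_on {y. y \<bullet> e = 0} (\<gamma> :: R3 \<Rightarrow> real) \<and>
        S \<inter> ball p r = {x \<in> ball p r. \<gamma> (x - (x \<bullet> e) *\<^sub>R e) < x \<bullet> e})"

record electrowetting =
  exterior :: "R3 set"          \<comment> \<open>\<open>\<Omega>\<^sub>e\<close>\<close>
  drop0 :: "R3 set"             \<comment> \<open>the reference drop \<open>\<Omega>\<^sub>L\<close>\<close>
  electrode :: "R3 set"         \<comment> \<open>\<open>\<Gamma>\<^sub>0\<close>\<close>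
  eps_G :: real
  eps_S :: real
  voltage :: real               \<comment> \<open>\<open>\<phi>\<^sub>0\<close>\<close>
  sigma_LG :: real
  sigma_LS :: real
  sigma_GS :: real
  density :: real
  gravity :: real
  drop_volume :: real           \<comment> \<open>\<open>V\<close>\<close>

definition solid :: "electrowetting \<Rightarrow> R3 set" where
  "solid P = {x \<in> exterior P. x $ 3 < 0}"

definition external_boundary :: "electrowetting \<Rightarrow> R3 set" where
  "external_boundary P = frontier (exterior P)"

text \<open>A domain is carried along with its gas region and its interfaces, because these are
  transported by the deformation; the solid region \<^term>\<open>solid P\<close> never changes.\<close>

record drop_domain =
  dom :: "R3 set"
  gas :: "R3 set"
  LS :: "R3 set"
  LG :: "R3 set"

definition reference :: "electrowetting \<Rightarrow> drop_domain" where
  "reference P = (let G = {x \<in> exterior P. x $ 3 > 0} - closure (drop0 P) in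
     \<lparr> dom = exterior P - closure (drop0 P),
       gas = G,
       LS = closure (drop0 P) \<inter> closure (solid P),
       LG = closure (drop0 P) \<inter> closure G \<rparr>)"

definition electrowetting_setting :: "electrowetting \<Rightarrow> bool" where
  "electrowetting_setting P \<longleftrightarrow>
     open (exterior P) \<and> bounded (exterior P) \<and> lipschitz_boundary (exterior P) \<and>
     open (drop0 P) \<and> lipschitz_boundary (drop0 P) \<and>
     drop0 P \<subseteq> {x \<in> exterior P. x $ 3 > 0} \<and>
     closure (drop0 P) \<inter> {x \<in> exterior P. x $ 3 = 0} \<noteq> {} \<and>
     open (dom (reference P)) \<and> lipschitz_boundary (dom (reference P)) \<and>
     electrode P \<subseteq> frontier (solid P) \<inter> external_boundary P \<and>
     eps_G P > 0 \<and> eps_S P > 0 \<and> voltage P \<ge> 0 \<and> sigma_LG P > 0"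

definition deform :: "(R3 \<Rightarrow> R3) \<Rightarrow> drop_domain \<Rightarrow> drop_domain" where
  "deform U \<Omega> = (let \<Phi> = (\<lambda>x. x + U x) in
     \<lparr> dom = \<Phi> ` dom \<Omega>, gas = \<Phi> ` gas \<Omega>, LS = \<Phi> ` LS \<Omega>, LG = \<Phi> ` LG \<Omega> \<rparr>)"

section \<open>Potential, energy and constraint\<close>

definition permittivity :: "electrowetting \<Rightarrow> drop_domain \<Rightarrow> R3 \<Rightarrow> real" where
  "permittivity P \<Omega> x = eps_G P * indicator (gas \<Omega>) x + eps_S P * indicator (solid P) x"

definition potential_space :: "electrowetting \<Rightarrow> drop_domain \<Rightarrow> real \<Rightarrow> (R3 \<Rightarrow> real) set" where
  "potential_space P \<Omega> c = {\<psi> \<in> H1 (dom \<Omega>).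
     trace_eq (dom \<Omega>) \<psi> (electrode P) 0 \<and> trace_eq (dom \<Omega>) \<psi> (LS \<Omega> \<union> LG \<Omega>) c}"

definition is_potential :: "electrowetting \<Rightarrow> drop_domain \<Rightarrow> (R3 \<Rightarrow> real) \<Rightarrow> bool" where
  "is_potential P \<Omega> \<phi> \<longleftrightarrow> \<phi> \<in> potential_space P \<Omega> (voltage P) \<and>
     (\<forall>\<psi> \<in> potential_space P \<Omega> 0.
        (LINT x|lebesgue_on (dom \<Omega>).
           permittivity P \<Omega> x * (wgrad (dom \<Omega>) \<phi> x \<bullet> wgrad (dom \<Omega>) \<psi> x)) = 0)"

text \<open>Unique as an equivalence class modulo null sets, hence \<open>SOME\<close> and not \<open>THE\<close>.\<close>

definition potential :: "electrowetting \<Rightarrow> drop_domain \<Rightarrow> R3 \<Rightarrow> real" where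
  "potential P \<Omega> = (SOME \<phi>. is_potential P \<Omega> \<phi>)"

definition energy :: "electrowetting \<Rightarrow> drop_domain \<Rightarrow> real" where
  "energy P \<Omega> =
    (let \<alpha> = density P * gravity P / sigma_LG P;
         \<mu> = (sigma_LS P - sigma_GS P) / sigma_LG P;
         \<delta> = 1 / sigma_LG P
     in - \<alpha> * (LINT x|lebesgue_on (dom \<Omega>). x $ 3)
        + \<mu> * measure surface_measure (LS \<Omega>)
        + measure surface_measure (LG \<Omega>)
        - \<delta> / 2 * (LINT x|lebesgue_on (dom \<Omega>).
            permittivity P \<Omega> x * (norm (wgrad (dom \<Omega>) (potential P \<Omega>) x))\<^sup>2))"

definition volume_constraint :: "electrowetting \<Rightarrow> drop_domain \<Rightarrow> real" where
  "volume_constraint P \<Omega> = measure lebesgue (exterior P - closure (dom \<Omega>)) - drop_volume P"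

definition lagrangian :: "electrowetting \<Rightarrow> drop_domain \<Rightarrow> real \<Rightarrow> real" where
  "lagrangian P \<Omega> l = energy P \<Omega> - l * volume_constraint P \<Omega>"

section \<open>Admissible domains and directional derivatives\<close>

text \<open>An element of \<open>C\<^sup>1(cl \<Omega>, R\<^sup>3)\<close> is represented by any of its continuously differentiable
  extensions to the whole space. Everything below depends only on the values on the closure of
  \<open>\<Omega>\<close>: there the derivative is determined by continuity from the open set \<open>\<Omega>\<close>.\<close>

definition C1_map :: "(R3 \<Rightarrow> R3) \<Rightarrow> bool" where
  "C1_map U \<longleftrightarrow> (\<exists>U' :: R3 \<Rightarrow> R3 \<Rightarrow>\<^sub>L R3.
     (\<forall>x. (U has_derivative blinfun_apply (U' x)) (at x)) \<and> continuous_on UNIV U')"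

definition C1_norm :: "R3 set \<Rightarrow> (R3 \<Rightarrow> R3) \<Rightarrow> real" where
  "C1_norm S U = (SUP x \<in> closure S. norm (U x))
               + (SUP x \<in> closure S. onorm (frechet_derivative U (at x)))"

definition displacements :: "electrowetting \<Rightarrow> drop_domain \<Rightarrow> (R3 \<Rightarrow> R3) set" where
  "displacements P \<Omega> = {U. C1_map U \<and> C1_norm (dom \<Omega>) U < 1 \<and>
     (\<forall>x \<in> solid P. U x $ 3 = 0) \<and>
     (\<forall>x \<in> external_boundary P \<inter> closure (dom \<Omega>). U x = 0)}"

definition admissible :: "electrowetting \<Rightarrow> drop_domain set" where
  "admissible P = {deform U (reference P) | U. U \<in> displacements P (reference P)}"

definition difference_quotient ::
    "(drop_domain \<Rightarrow> real) \<Rightarrow> drop_domain \<Rightarrow> (R3 \<Rightarrow> R3) \<Rightarrow> real \<Rightarrow> real" where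
  "difference_quotient K \<Omega> U t =
     (let Kstar = (\<lambda>W. K (deform W \<Omega>)) in (Kstar (\<lambda>x. t *\<^sub>R U x) - Kstar (\<lambda>x. 0)) / t)"

definition has_directional_derivative ::
    "(drop_domain \<Rightarrow> real) \<Rightarrow> drop_domain \<Rightarrow> (R3 \<Rightarrow> R3) \<Rightarrow> bool" where
  "has_directional_derivative K \<Omega> U \<longleftrightarrow> (\<exists>l. (difference_quotient K \<Omega> U \<longlongrightarrow> l) (at 0))"

definition directional_derivative ::
    "(drop_domain \<Rightarrow> real) \<Rightarrow> drop_domain \<Rightarrow> (R3 \<Rightarrow> R3) \<Rightarrow> real" where
  "directional_derivative K \<Omega> U = Lim (at 0) (difference_quotient K \<Omega> U)"

definition saddle_point :: "electrowetting \<Rightarrow> drop_domain \<Rightarrow> real \<Rightarrow> bool" where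
  "saddle_point P \<Omega>s ls \<longleftrightarrow> \<Omega>s \<in> admissible P \<and>
     (\<forall>\<Omega> \<in> admissible P. \<forall>l.
        lagrangian P \<Omega>s l \<le> lagrangian P \<Omega>s ls \<and> lagrangian P \<Omega>s ls \<le> lagrangian P \<Omega> ls)"

end

theory Submission
  imports Defs
begin

text \<open>
  The saddle point property says that \<open>\<Omega>s\<close> minimises \<open>J - ls C\<close> over the admissible domains.
  The set of admissible domains is described by displacements of the reference domain, though,
  whereas directional derivatives at \<open>\<Omega>s\<close> use displacements of \<open>\<Omega>s\<close> itself. The point of the proof
  is that \<open>(Id + tU)(\<Omega>s)\<close> remains admissible for all small \<open>t\<close> of either sign; then the derivative
  of \<open>J - ls C\<close> along \<open>U\<close> is nonnegative from the right and nonpositive from the left, so it is \<open>0\<close>.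

  If \<open>\<Omega>s = (Id + W)(\<Omega>\<^sup>0)\<close>, then \<open>(Id + tU)(\<Omega>s)\<close> is obtained from \<open>\<Omega>\<^sup>0\<close> by the displacement
  \<open>W + t U \<circ> (Id + W)\<close>. Its norm is a perturbation of size \<open>O(\<bar>t\<bar>)\<close> of the norm of \<open>W\<close>, because
  \<open>\<Omega>\<^sup>0\<close> is bounded, so it stays below \<open>1\<close>. It vanishes on the external boundary because
  \<open>Id + W\<close> fixes the points of that boundary, where \<open>U\<close> vanishes too. Its vertical component vanishes on the solid as soon as \<open>Id + W\<close> maps the solid
  into itself, which is the only step with some content: \<open>W\<close> is horizontal there, so a point could
  leave the solid only through the external boundary, where \<open>W\<close> is zero, and a displacement whose
  derivative has norm below \<open>1\<close> is too short to reach or pass a zero of itself along a segment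
  (lemma \<open>displacement_preserves_solid\<close>).
\<close>

section \<open>Continuously differentiable displacements\<close>

lemma C1_map_continuous: "C1_map U \<Longrightarrow> continuous_on S U"
  unfolding C1_map_def
  by (meson continuous_at_imp_continuous_on has_derivative_continuous)

lemma C1_map_add_scaled:
  assumes "C1_map A" "C1_map B"
  shows "C1_map (\<lambda>x. A x + t *\<^sub>R B x)"
proof -
  obtain A' :: "R3 \<Rightarrow> R3 \<Rightarrow>\<^sub>L R3" where
    A': "\<And>x. (A has_derivative blinfun_apply (A' x)) (at x)" and cA': "continuous_on UNIV A'"
    using assms(1) unfolding C1_map_def by blast
  obtain B' :: "R3 \<Rightarrow> R3 \<Rightarrow>\<^sub>L R3" where
    B': "\<And>x. (B has_derivative blinfun_apply (B' x)) (at x)" and cB': "continuous_on UNIV B'"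
    using assms(2) unfolding C1_map_def by blast
  have "((\<lambda>x. A x + t *\<^sub>R B x) has_derivative blinfun_apply (A' x + t *\<^sub>R B' x)) (at x)" for x
    using has_derivative_add[OF A' has_derivative_scaleR_right[OF B', of t], of x]
    by (simp add: plus_blinfun.rep_eq scaleR_blinfun.rep_eq)
  moreover have "continuous_on UNIV (\<lambda>x. A' x + t *\<^sub>R B' x)"
    by (intro continuous_intros cA' cB')
  ultimately show ?thesis
    unfolding C1_map_def by (intro exI[of _ "\<lambda>x. A' x + t *\<^sub>R B' x"]) simp
qed

lemma C1_map_compose_displacement:
  assumes "C1_map W" "C1_map U"
  shows "C1_map (\<lambda>x. U (x + W x))"
proof -
  obtain W' :: "R3 \<Rightarrow> R3 \<Rightarrow>\<^sub>L R3" where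
    W': "\<And>x. (W has_derivative blinfun_apply (W' x)) (at x)" and cW': "continuous_on UNIV W'"
    using assms(1) unfolding C1_map_def by blast
  obtain U' :: "R3 \<Rightarrow> R3 \<Rightarrow>\<^sub>L R3" where
    U': "\<And>x. (U has_derivative blinfun_apply (U' x)) (at x)" and cU': "continuous_on UNIV U'"
    using assms(2) unfolding C1_map_def by blast
  define D where "D x = U' (x + W x) o\<^sub>L (id_blinfun + W' x)" for x
  have "((\<lambda>x. U (x + W x)) has_derivative blinfun_apply (D x)) (at x)" for x
  proof -
    have "((\<lambda>x. x + W x) has_derivative (\<lambda>h. h + W' x h)) (at x)"
      by (intro derivative_intros W')
    then have "((\<lambda>x. U (x + W x)) has_derivative (\<lambda>h. U' (x + W x) (h + W' x h))) (at x)"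
      using has_derivative_compose U' by blast
    moreover have "blinfun_apply (D x) = (\<lambda>h. U' (x + W x) (h + W' x h))"
      by (auto simp: D_def plus_blinfun.rep_eq)
    ultimately show ?thesis by simp
  qed
  moreover have "continuous_on UNIV D"
  proof -
    have "continuous_on UNIV (\<lambda>x. U' (x + W x))"
      by (rule continuous_on_compose2[OF cU' _ subset_UNIV])
        (intro continuous_intros C1_map_continuous assms(1))
    then show ?thesis
      unfolding D_def by (intro continuous_intros cW')
  qed
  ultimately show ?thesis unfolding C1_map_def by blast
qed

lemma bdd_above_norm_and_derivative:
  assumes "C1_map U" "bounded S"
  shows "bdd_above ((\<lambda>x. norm (U x)) ` closure S)"
    and "bdd_above ((\<lambda>x. onorm (frechet_derivative U (at x))) ` closure S)"
proof -
  obtain U' :: "R3 \<Rightarrow> R3 \<Rightarrow>\<^sub>L R3" where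
    U': "\<And>x. (U has_derivative blinfun_apply (U' x)) (at x)" and cU': "continuous_on UNIV U'"
    using assms(1) unfolding C1_map_def by blast
  have K: "compact (closure S)" using assms(2) by simp
  show "bdd_above ((\<lambda>x. norm (U x)) ` closure S)"
    by (intro bounded_imp_bdd_above compact_imp_bounded compact_continuous_image K
        continuous_intros C1_map_continuous assms(1))
  have eq: "onorm (frechet_derivative U (at x)) = norm (U' x)" for x
    using frechet_derivative_at[OF U'[of x]] by (simp add: norm_blinfun.rep_eq)
  have "bdd_above ((\<lambda>x. norm (U' x)) ` closure S)"
    by (intro bounded_imp_bdd_above compact_imp_bounded compact_continuous_image K
        continuous_intros continuous_on_subset[OF cU'] subset_UNIV)
  then show "bdd_above ((\<lambda>x. onorm (frechet_derivative U (at x))) ` closure S)"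
    by (simp add: eq)
qed

text \<open>The estimate needs a nonempty set: the two suprema over the empty set share one unspecified
  value, which may be negative.\<close>

lemma C1_norm_add_scaled_le:
  assumes A: "C1_map A" and B: "C1_map B" and S: "bounded S" "S \<noteq> {}"
  shows "C1_norm S (\<lambda>x. A x + t *\<^sub>R B x) \<le> C1_norm S A + \<bar>t\<bar> * C1_norm S B"
proof -
  have ne: "closure S \<noteq> {}" using S(2) by simp
  note bA = bdd_above_norm_and_derivative[OF A S(1)]
  note bB = bdd_above_norm_and_derivative[OF B S(1)]
  have dA: "A differentiable at x" and dB: "B differentiable at x" for x
    using A B unfolding C1_map_def differentiable_def by blast+
  have val: "(SUP x\<in>closure S. norm (A x + t *\<^sub>R B x))
      \<le> (SUP x\<in>closure S. norm (A x)) + \<bar>t\<bar> * (SUP x\<in>closure S. norm (B x))"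
  proof (rule cSUP_least[OF ne])
    fix x assume x: "x \<in> closure S"
    have "norm (A x + t *\<^sub>R B x) \<le> norm (A x) + \<bar>t\<bar> * norm (B x)"
      by (metis norm_scaleR norm_triangle_ineq)
    also have "\<dots> \<le> (SUP x\<in>closure S. norm (A x)) + \<bar>t\<bar> * (SUP x\<in>closure S. norm (B x))"
      by (intro add_mono mult_left_mono cSUP_upper[OF x] bA bB) auto
    finally show "norm (A x + t *\<^sub>R B x) \<le> \<dots>" .
  qed
  have der: "(SUP x\<in>closure S. onorm (frechet_derivative (\<lambda>x. A x + t *\<^sub>R B x) (at x)))
      \<le> (SUP x\<in>closure S. onorm (frechet_derivative A (at x)))
        + \<bar>t\<bar> * (SUP x\<in>closure S. onorm (frechet_derivative B (at x)))"
  proof (rule cSUP_least[OF ne])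
    fix x assume x: "x \<in> closure S"
    let ?A = "frechet_derivative A (at x)" and ?B = "frechet_derivative B (at x)"
    have hA: "(A has_derivative ?A) (at x)" and hB: "(B has_derivative ?B) (at x)"
      using dA dB frechet_derivative_works by blast+
    have "((\<lambda>x. A x + t *\<^sub>R B x) has_derivative (\<lambda>h. ?A h + t *\<^sub>R ?B h)) (at x)"
      by (intro derivative_intros hA hB)
    then have eq: "frechet_derivative (\<lambda>x. A x + t *\<^sub>R B x) (at x) = (\<lambda>h. ?A h + t *\<^sub>R ?B h)"
      by (rule frechet_derivative_at[symmetric])
    have lA: "bounded_linear ?A" and lB: "bounded_linear ?B"
      using hA hB has_derivative_bounded_linear by blast+
    have "onorm (\<lambda>h. ?A h + t *\<^sub>R ?B h) \<le> onorm ?A + \<bar>t\<bar> * onorm ?B"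
      using onorm_triangle[OF lA bounded_linear_const_scaleR[OF lB, of t]]
        onorm_scaleR[OF lB, of t] by simp
    also have "\<dots> \<le> (SUP x\<in>closure S. onorm (frechet_derivative A (at x)))
        + \<bar>t\<bar> * (SUP x\<in>closure S. onorm (frechet_derivative B (at x)))"
      by (intro add_mono mult_left_mono cSUP_upper[OF x] bA bB) auto
    finally show "onorm (frechet_derivative (\<lambda>x. A x + t *\<^sub>R B x) (at x)) \<le> \<dots>"
      by (simp add: eq)
  qed
  show ?thesis
    using val der unfolding C1_norm_def by (simp add: algebra_simps)
qed

lemma eventually_C1_norm_less_1:
  assumes "C1_map A" "C1_map B" "bounded S" and less: "C1_norm S A < 1"
  shows "\<forall>\<^sub>F t in at 0. C1_norm S (\<lambda>x. A x + t *\<^sub>R B x) < 1"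
proof (cases "S = {}")
  case True
  then show ?thesis using less by (simp add: C1_norm_def)
next
  case False
  have "((\<lambda>t. C1_norm S A + \<bar>t\<bar> * C1_norm S B) \<longlongrightarrow> C1_norm S A + \<bar>0\<bar> * C1_norm S B) (at 0)"
    by (intro tendsto_intros)
  then have "\<forall>\<^sub>F t in at 0. C1_norm S A + \<bar>t\<bar> * C1_norm S B < 1"
    using less by (intro order_tendstoD(2)) auto
  then show ?thesis
    by (rule eventually_mono) (rule le_less_trans[OF C1_norm_add_scaled_le[OF assms(1-3) False]])
qed

section \<open>Displacements preserve the solid\<close>

lemma solid_subset_reference:
  assumes "electrowetting_setting P"
  shows "solid P \<subseteq> dom (reference P)"
proof -
  have "drop0 P \<subseteq> {x. x $ 3 \<ge> 0}"
    using assms unfolding electrowetting_setting_def by force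
  then have "closure (drop0 P) \<subseteq> {x. x $ 3 \<ge> 0}"
    by (rule closure_minimal) (intro closed_Collect_le continuous_intros)
  then show ?thesis by (force simp: solid_def reference_def Let_def)
qed

lemma bounded_reference:
  assumes "electrowetting_setting P"
  shows "bounded (dom (reference P))"
  by (rule bounded_subset[of "exterior P"])
    (use assms in \<open>auto simp: electrowetting_setting_def reference_def Let_def\<close>)

lemma C1_norm_bounds_derivative:
  assumes U: "C1_map U" and S: "bounded S" and less: "C1_norm S U < 1"
  obtains k where "k < 1" "\<And>x. x \<in> closure S \<Longrightarrow> onorm (frechet_derivative U (at x)) \<le> k"
proof (cases "S = {}")
  case True
  then show ?thesis using that[of 0] by simp
next
  case False
  note b = bdd_above_norm_and_derivative[OF U S]
  obtain x where x: "x \<in> closure S" using False closure_subset by blast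
  have "0 \<le> norm (U x)" by simp
  also have "\<dots> \<le> (SUP x \<in> closure S. norm (U x))" by (rule cSUP_upper[OF x b(1)])
  finally have "(SUP x \<in> closure S. onorm (frechet_derivative U (at x))) < 1"
    using less unfolding C1_norm_def by simp
  then show ?thesis using that cSUP_upper[OF _ b(2)] by blast
qed

text \<open>Suppose \<open>x + W x\<close> is outside the solid, and let \<open>p\<close> be the first point outside it on the
  segment from \<open>x\<close> to \<open>x + W x\<close>. The segment is horizontal, so \<open>p\<close> lies on the external boundary and
  \<open>W p = 0\<close>. Up to \<open>p\<close> the segment runs inside the closure of the reference domain, where the
  derivative of \<open>W\<close> has norm at most \<open>k < 1\<close>; hence \<open>\<bar>W x\<bar> \<le> k \<bar>x - p\<bar> < \<bar>x - p\<bar> \<le> \<bar>W x\<bar>\<close>, which is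
  absurd. Arguing along this one segment avoids any convexity of the domain.\<close>

lemma displacement_preserves_solid:
  assumes setting: "electrowetting_setting P"
    and W: "W \<in> displacements P (reference P)" and x: "x \<in> solid P"
  shows "x + W x \<in> solid P"
proof (rule ccontr)
  assume out: "x + W x \<notin> solid P"
  define y where "y = x + W x"
  have opn: "open (exterior P)" using setting by (simp add: electrowetting_setting_def)
  have C1: "C1_map W" and less: "C1_norm (dom (reference P)) W < 1"
    and horizontal: "W x $ 3 = 0"
    and boundary: "\<And>z. z \<in> external_boundary P \<Longrightarrow> z \<in> closure (dom (reference P)) \<Longrightarrow> W z = 0"
    using W x by (auto simp: displacements_def)
  have xE: "x \<in> exterior P" and x3: "x $ 3 < 0" using x by (auto simp: solid_def)
  have y3: "y $ 3 = x $ 3" using horizontal by (simp add: y_def)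
  have yE: "y \<notin> exterior P" using out y3 x3 by (auto simp: solid_def y_def)
  have below: "z $ 3 < 0" if z: "z \<in> closed_segment x y" for z
  proof -
    obtain u where "z = (1 - u) *\<^sub>R x + u *\<^sub>R y" using z unfolding in_segment by blast
    then have "z $ 3 = (1 - u) * x $ 3 + u * y $ 3" by simp
    then have "z $ 3 = x $ 3" using y3 by (simp add: algebra_simps)
    then show ?thesis using x3 by simp
  qed
  have "compact (closed_segment x y - exterior P)"
    by (intro compact_diff compact_segment opn)
  moreover have "y \<in> closed_segment x y - exterior P" using yE by simp
  ultimately obtain p where p: "p \<in> closed_segment x y - exterior P"
    and first: "\<And>z. z \<in> closed_segment x y - exterior P \<Longrightarrow> dist x p \<le> dist x z"
    using distance_attains_inf[of "closed_segment x y - exterior P" x]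
    by (metis compact_imp_closed empty_iff)
  have xp: "x \<noteq> p" using p xE by auto
  have sub: "closed_segment x p \<subseteq> closed_segment x y"
    using p by (simp add: subset_closed_segment)
  have inside: "open_segment x p \<subseteq> solid P"
  proof
    fix z assume z: "z \<in> open_segment x p"
    then have "dist x z < dist x p" using dist_in_open_segment by (metis dist_commute)
    moreover have zs: "z \<in> closed_segment x y" using z sub open_closed_segment by blast
    ultimately have "z \<in> exterior P" using first[of z] by force
    then show "z \<in> solid P" using below[OF zs] by (simp add: solid_def)
  qed
  have cl: "closed_segment x p \<subseteq> closure (solid P)"
    using closure_mono[OF inside] xp by (simp add: closure_open_segment)
  have clD: "closed_segment x p \<subseteq> closure (dom (reference P))"
    using cl closure_mono[OF solid_subset_reference[OF setting]] by blast
  have "p \<in> closure (exterior P)"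
    using cl closure_mono[of "solid P" "exterior P"] by (auto simp: solid_def)
  then have "p \<in> external_boundary P"
    using p opn by (simp add: external_boundary_def frontier_def interior_open)
  then have Wp: "W p = 0" using boundary clD by auto
  obtain k where k: "k < 1"
    and Dk: "\<And>z. z \<in> closure (dom (reference P)) \<Longrightarrow> onorm (frechet_derivative W (at z)) \<le> k"
    using C1_norm_bounds_derivative[OF C1 bounded_reference[OF setting] less] by metis
  have "norm (W x - W p) \<le> k * norm (x - p)"
  proof (rule differentiable_bound[where f' = "\<lambda>z. frechet_derivative W (at z)"])
    show "convex (closed_segment x p)" by simp
    show "(W has_derivative frechet_derivative W (at z)) (at z within closed_segment x p)" for z
      using C1 unfolding C1_map_def
      by (metis differentiableI frechet_derivative_works has_derivative_at_withinI)
    show "onorm (frechet_derivative W (at z)) \<le> k" if "z \<in> closed_segment x p" for z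
      using Dk clD that by blast
  qed auto
  moreover have "k * norm (x - p) < norm (x - p)" using k xp by simp
  moreover have "norm (x - p) \<le> norm (W x)"
    using first[of y] yE by (simp add: dist_norm y_def)
  ultimately show False using Wp by simp
qed

section \<open>Small deformations of an admissible domain are admissible\<close>

lemma deform_deform:
  "deform U (deform W \<Omega>) = deform (\<lambda>x. W x + U (x + W x)) \<Omega>"
  by (simp add: deform_def Let_def image_image add.assoc)

lemma eventually_deform_admissible:
  assumes setting: "electrowetting_setting P"
    and adm: "\<Omega> \<in> admissible P" and U: "U \<in> displacements P \<Omega>"
  shows "\<forall>\<^sub>F t in at 0. deform (\<lambda>x. t *\<^sub>R U x) \<Omega> \<in> admissible P"
proof -
  obtain W where W: "W \<in> displacements P (reference P)" and \<Omega>: "\<Omega> = deform W (reference P)"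
    using adm unfolding admissible_def by blast
  let ?R = "dom (reference P)"
  have C1W: "C1_map W" and normW: "C1_norm ?R W < 1" using W by (auto simp: displacements_def)
  have C1U: "C1_map U" using U by (auto simp: displacements_def)
  have C1UW: "C1_map (\<lambda>x. U (x + W x))" by (rule C1_map_compose_displacement[OF C1W C1U])
  have "\<forall>\<^sub>F t in at 0. C1_norm ?R (\<lambda>x. W x + t *\<^sub>R U (x + W x)) < 1"
    by (rule eventually_C1_norm_less_1[OF C1W C1UW bounded_reference[OF setting] normW])
  then show ?thesis
  proof eventually_elim
    case (elim t)
    let ?V = "\<lambda>x. W x + t *\<^sub>R U (x + W x)"
    have "?V x $ 3 = 0" if "x \<in> solid P" for x
      using that W U displacement_preserves_solid[OF setting W that]
      by (simp add: displacements_def)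
    moreover have "?V x = 0" if x: "x \<in> external_boundary P" "x \<in> closure ?R" for x
    proof -
      have Wx: "W x = 0" using W x by (simp add: displacements_def)
      \<comment> \<open>\<open>U\<close> is known to vanish only at boundary points adherent to \<open>\<Omega>\<close>; the fixed point \<open>x\<close> of
        \<open>Id + W\<close> is one, as a limit of images of points of the reference domain.\<close>
      have "continuous_on (closure ?R) (\<lambda>x. x + W x)"
        by (intro continuous_intros C1_map_continuous C1W)
      then have "(\<lambda>x. x + W x) ` closure ?R \<subseteq> closure ((\<lambda>x. x + W x) ` ?R)"
        by (rule image_closure_subset) (auto simp: closure_subset)
      then have "x + W x \<in> closure (dom \<Omega>)"
        using x(2) by (auto simp: \<Omega> deform_def Let_def)
      then have "U x = 0" using U x(1) Wx by (simp add: displacements_def)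
      then show ?thesis using Wx by simp
    qed
    ultimately have "?V \<in> displacements P (reference P)"
      using elim C1_map_add_scaled[OF C1W C1UW, of t]
      by (simp add: displacements_def)
    moreover have "deform (\<lambda>x. t *\<^sub>R U x) \<Omega> = deform ?V (reference P)"
      by (simp add: \<Omega> deform_deform)
    ultimately show ?case unfolding admissible_def by blast
  qed
qed

section \<open>The first-order condition\<close>

lemma limit_of_difference_quotient_at_minimum:
  fixes f :: "real \<Rightarrow> real"
  assumes lim: "((\<lambda>t. (f t - f 0) / t) \<longlongrightarrow> l) (at 0)" and min: "\<forall>\<^sub>F t in at 0. f 0 \<le> f t"
  shows "l = 0"
proof (rule antisym)
  have left: "((\<lambda>t. (f t - f 0) / t) \<longlongrightarrow> l) (at_left 0)" "\<forall>\<^sub>F t in at_left 0. f 0 \<le> f t"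
    and right: "((\<lambda>t. (f t - f 0) / t) \<longlongrightarrow> l) (at_right 0)" "\<forall>\<^sub>F t in at_right 0. f 0 \<le> f t"
    using lim min by (auto simp: filterlim_at_split eventually_at_split)
  have "\<forall>\<^sub>F t in at_left 0. (f t - f 0) / t \<le> 0"
    using left(2) eventually_at_left_real[of "-1" 0, simplified]
    by eventually_elim (simp add: divide_nonneg_neg)
  then show "l \<le> 0" by (rule tendsto_upperbound[OF left(1)]) simp
  have "\<forall>\<^sub>F t in at_right 0. 0 \<le> (f t - f 0) / t"
    using right(2) eventually_at_right_real[of 0 1, simplified]
    by eventually_elim simp
  then show "0 \<le> l" by (rule tendsto_lowerbound[OF right(1)]) simp
qed

lemma directional_derivative_tendsto:
  assumes "has_directional_derivative K \<Omega> U"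
  shows "(difference_quotient K \<Omega> U \<longlongrightarrow> directional_derivative K \<Omega> U) (at 0)"
  using assms unfolding has_directional_derivative_def directional_derivative_def
  by (metis tendsto_Lim trivial_limit_at)

theorem proposition2p2:
  fixes P :: electrowetting and \<Omega>s :: drop_domain and ls :: real and U :: "real^3 \<Rightarrow> real^3"
  assumes "electrowetting_setting P"
    and "saddle_point P \<Omega>s ls"
    and "U \<in> displacements P \<Omega>s"
    and "has_directional_derivative (energy P) \<Omega>s U"
    and "has_directional_derivative (volume_constraint P) \<Omega>s U"
  shows "directional_derivative (energy P) \<Omega>s U =
         ls * directional_derivative (volume_constraint P) \<Omega>s U"
proof -
  let ?dJ = "directional_derivative (energy P) \<Omega>s U"
    and ?dC = "directional_derivative (volume_constraint P) \<Omega>s U"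
  define f where "f t = lagrangian P (deform (\<lambda>x. t *\<^sub>R U x) \<Omega>s) ls" for t
  have f0: "f 0 = lagrangian P \<Omega>s ls" by (cases \<Omega>s) (simp add: f_def deform_def)
  have adm: "\<Omega>s \<in> admissible P" and
    min: "\<And>\<Omega>. \<Omega> \<in> admissible P \<Longrightarrow> f 0 \<le> lagrangian P \<Omega> ls"
    using assms(2) by (auto simp: saddle_point_def f0)
  have "((\<lambda>t. difference_quotient (energy P) \<Omega>s U t
      - ls * difference_quotient (volume_constraint P) \<Omega>s U t) \<longlongrightarrow> ?dJ - ls * ?dC) (at 0)"
    by (intro tendsto_intros directional_derivative_tendsto assms)
  also have "(\<lambda>t. difference_quotient (energy P) \<Omega>s U t
      - ls * difference_quotient (volume_constraint P) \<Omega>s U t) = (\<lambda>t. (f t - f 0) / t)"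
    by (auto simp: difference_quotient_def Let_def f_def lagrangian_def
        diff_divide_distrib add_divide_distrib algebra_simps)
  finally have "((\<lambda>t. (f t - f 0) / t) \<longlongrightarrow> ?dJ - ls * ?dC) (at 0)" .
  moreover have "\<forall>\<^sub>F t in at 0. f 0 \<le> f t"
    using eventually_deform_admissible[OF assms(1) adm assms(3)]
    by eventually_elim (use min in \<open>simp add: f_def\<close>)
  ultimately have "?dJ - ls * ?dC = 0" by (rule limit_of_difference_quotient_at_minimum)
  then show ?thesis by simp
qed

end
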